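(* Let $N\ge 2$, $d\ge 1$, and let $\psi$, $\mathcal{V}$ satisfy the standing assumptions stated in the context. Then for every initial condition $z_0=(r_0,v_0)\in\mathbb{R}^{Nd}\times\mathbb{R}^{Nd}$ the port-Hamiltonian system $$\frac{\mathrm{d}}{\mathrm{d}t}z=\left[\begin{pmatrix}0&I\\-I&0\end{pmatrix}-\begin{pmatrix}0&0\\0&\Psi(z)\end{pmatrix}\right]\frac{\partial\mathcal{H}^N(z)}{\partial z},\qquad z(0)=z_0,$$ possesses a unique global solution $z=(r,v)$ (on $[0,\infty)$), and it satisfies the dissipativity inequality $$\frac{\mathrm{d}}{\mathrm{d}t}\mathcal{H}^N(z)=-\langle v-\mathbf{1}\bar v,\Psi(z)(v-\mathbf{1}\bar v)\rangle\le 0,$$ where $\bar v:=\frac1N\sum_{j=1}^N v_j(0)$. Further, the velocity of the center of mass is conserved, that is, $\bar v=\frac1N\sum_{j=1}^N v_j(t)$ for all $t\ge 0$.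
   Context: States are $z=(r,v)=(r_1,\dots,r_N,v_1,\dots,v_N)$ with $r_i,v_i\in\mathbb{R}^d$. The function $\psi:\mathbb{R}\to\mathbb{R}_{\ge 0}$ is the alignment strength and $\mathcal{V}:\mathbb{R}^d\to\mathbb{R}$ is continuously differentiable with $\nabla\mathcal{V}(-x)=-\nabla\mathcal{V}(x)$ for all $x$. Set, for $i=1,\dots,N$, $$F_i(t,x,v)=\frac1N\sum_{j=1}^N\psi(|x_j-x_i|)(v_j-v_i)-\frac1N\sum_{j=1}^N\nabla\mathcal{V}(x_i-x_j).$$ Standing assumptions: (1) each $F_i$ is continuous; (2) there is $C>0$ with $|F_i(t,x,v)|\le C(1+|x|+|v|)$ for all $i$, $t$ and all $x,v\in\mathbb{R}^{dN}$; (3) for every compact $K\subset\mathbb{R}^{dN}\times\mathbb{R}^{dN}$ there is $L_K>0$ such that every $F_i$ is $L_K$-Lipschitz on $K$ with respect to $(x,v)$. With $\bar v=\frac1N\sum_{j}v_j(0)\in\mathbb{R}^d$ (the mean of the initial velocities), write $v-\mathbf{1}\bar v=(v_1-\bar v,\dots,v_N-\bar v)$. The Hamiltonian is $$\mathcal{H}^N(z)=\frac12\sum_{i=1}^N\Big((v_i-\bar v)^\top(v_i-\bar v)+\frac1N\sum_{j=1}^N\mathcal{V}(r_i-r_j)\Big),$$ where in computing $\partial\mathcal{H}^N/\partial z$ the vector $\bar v$ is treated as a constant, so $\partial\mathcal{H}^N/\partial v=v-\mathbf{1}\bar v$ and $\partial\mathcal{H}^N/\partial r_i=\frac1N\sum_j\nabla\mathcal{V}(r_i-r_j)$.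 $\Psi(z)$ is the symmetric $N\times N$ block matrix (each scalar entry multiplying the $d\times d$ identity) with off-diagonal entries $\Psi(z)_{ij}=-\frac1N\psi(|r_j-r_i|)$, $i\neq j$, and diagonal entries $\Psi(z)_{ii}=\frac1N\sum_{j\ne i}\psi(|r_j-r_i|)$. *)

theory Defs
  imports "HOL-Analysis.Analysis"
begin

(* The positions r and the velocities v of N = CARD('n) particles in R^d, d = CARD('d), are
   elements of real^'d^'n, so r $ i is the position of particle i and norm is the Euclidean norm
   of R^(dN). *)
type_synonym ('d, 'n) config = "real^'d^'n"
type_synonym ('d, 'n) state = "('d, 'n) config \<times> ('d, 'n) config"

(* Only meaningful where f is differentiable. *)
definition grad :: "('a::real_inner \<Rightarrow> real) \<Rightarrow> 'a \<Rightarrow> 'a" where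
  "grad f x = (THE D. GDERIV f x :> D)"

(* The force does not depend on its time argument t. *)
definition force ::
  "(real \<Rightarrow> real) \<Rightarrow> (real^'d \<Rightarrow> real) \<Rightarrow> 'n::finite \<Rightarrow> real \<Rightarrow>
    ('d::finite, 'n) config \<Rightarrow> ('d, 'n) config \<Rightarrow> real^'d" where
  "force \<psi> V i t x v =
     (1 / real CARD('n)) *\<^sub>R (\<Sum>j\<in>UNIV. \<psi> (norm (x $ j - x $ i)) *\<^sub>R (v $ j - v $ i))
     - (1 / real CARD('n)) *\<^sub>R (\<Sum>j\<in>UNIV. grad V (x $ i - x $ j))"

definition mean_velocity :: "('d::finite, 'n::finite) config \<Rightarrow> real^'d" where
  "mean_velocity v = (1 / real CARD('n)) *\<^sub>R (\<Sum>j\<in>UNIV. v $ j)"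

(* v - 1 c *)
definition centred :: "real^'d \<Rightarrow> ('d::finite, 'n::finite) config \<Rightarrow> ('d, 'n) config" where
  "centred c v = v - (\<chi> i. c)"

(* The vector c stands for the mean initial velocity. It is a separate argument because it is
   held constant when the gradient with respect to the state is taken. *)
definition hamiltonian ::
  "(real^'d \<Rightarrow> real) \<Rightarrow> real^'d \<Rightarrow> ('d::finite, 'n::finite) state \<Rightarrow> real" where
  "hamiltonian V c = (\<lambda>(r, v).
     1 / 2 * (\<Sum>i\<in>UNIV. (v $ i - c) \<bullet> (v $ i - c)
                 + 1 / real CARD('n) * (\<Sum>j\<in>UNIV. V (r $ i - r $ j))))"

definition Psi :: "(real \<Rightarrow> real) \<Rightarrow> ('d::finite, 'n::finite) state \<Rightarrow> real^'n^'n" where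
  "Psi \<psi> = (\<lambda>(r, v). \<chi> i j.
     if i = j then 1 / real CARD('n) * (\<Sum>k\<in>UNIV - {i}. \<psi> (norm (r $ k - r $ i)))
     else - (1 / real CARD('n) * \<psi> (norm (r $ j - r $ i))))"

(* The action on a state of the 2 x 2 block matrix with N x N blocks A, B, C, D, every scalar entry
   multiplying the d x d identity. A configuration w is the N x d matrix with rows w $ i, so the
   matrix product A ** w is the configuration whose i-th entry is the sum of A $ i $ k times w $ k
   over k. *)
definition block_apply ::
  "real^'n^'n \<Rightarrow> real^'n^'n \<Rightarrow> real^'n^'n \<Rightarrow> real^'n^'n \<Rightarrow>
    ('d::finite, 'n::finite) state \<Rightarrow> ('d, 'n) state" where
  "block_apply A B C D = (\<lambda>(x, y). (A ** x + B ** y, C ** x + D ** y))"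

definition ph_field ::
  "(real \<Rightarrow> real) \<Rightarrow> (real^'d \<Rightarrow> real) \<Rightarrow> real^'d \<Rightarrow>
    ('d::finite, 'n::finite) state \<Rightarrow> ('d, 'n) state" where
  "ph_field \<psi> V c z =
     block_apply 0 (mat 1) (- mat 1) 0 (grad (hamiltonian V c) z)
     - block_apply 0 0 0 (Psi \<psi> z) (grad (hamiltonian V c) z)"

(* A curve is a total function on the reals; only its values on [0, \<infinity>) matter, and the
   derivative at 0 is one-sided. *)
definition global_solution ::
  "(real \<Rightarrow> real) \<Rightarrow> (real^'d \<Rightarrow> real) \<Rightarrow>
    ('d::finite, 'n::finite) state \<Rightarrow> (real \<Rightarrow> ('d, 'n) state) \<Rightarrow> bool" where
  "global_solution \<psi> V z0 z \<longleftrightarrow>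
     z 0 = z0 \<and>
     (\<forall>t\<ge>0. (z has_vector_derivative
        ph_field \<psi> V (mean_velocity (snd (z 0))) (z t)) (at t within {0..}))"

end

(* The oddness of grad V turns the r-gradient of the Hamiltonian into the interaction force, so the
   port-Hamiltonian field is z' = (v - 1c, F(r, v)), locally Lipschitz and of linear growth. Growth
   confines solutions on [0, T] to a ball; composing the field with the nearest-point projection
   onto that ball makes it bounded and globally Lipschitz without changing these solutions, and
   then Banach's fixed point theorem in a norm with weight exp(-a t) applies. The energy identity is
   the chain rule, in which the skew-symmetric part cancels; its sign comes from
   <u, Psi u> = 1/(2N) sum_{i,j} psi(|r_j - r_i|) |u_i - u_j|^2. The forces sum to zero by
   antisymmetry, which keeps the mean velocity constant. *)

theory Submission
  imports Defs
begin

section \<open>Existence for bounded, globally Lipschitz right-hand sides\<close>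

lemma at_within_atLeast_eq_Icc:
  fixes a t b :: real
  assumes "t < b"
  shows "at t within {a..b} = at t within {a..}"
  by (rule at_within_nhd[of _ "{..<b}"]) (use assms in auto)

text \<open>The Picard map is a contraction on the whole half-line once curves are weighted by
  exp(-a t). The bound on \<open>g\<close> makes the integrals grow at most linearly, so the
  weighted integral is a bounded function.\<close>

lemma lipschitz_bounded_ode_ex:
  fixes g :: "'a::euclidean_space \<Rightarrow> 'a"
  assumes L: "L-lipschitz_on UNIV g" and B: "\<And>x. norm (g x) \<le> B"
  shows "\<exists>z. z 0 = x0 \<and> (\<forall>t\<ge>0. (z has_vector_derivative g (z t)) (at t within {0..}))"
proof -
  have L0: "0 \<le> L" using L by (rule lipschitz_on_nonneg)
  have B0: "0 \<le> B" using B[of undefined] norm_ge_zero order_trans by blast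
  \<comment> \<open>This rate gives \<open>L / a \<le> 1 / 2\<close>, the contraction factor; the
    summand 1 keeps it positive when \<open>L = 0\<close>.\<close>
  define a where "a = 2 * L + 1"
  have a0: "a > 0" using L0 by (simp add: a_def)
  have g_cont: "continuous_on S g" for S
    using lipschitz_on_continuous_on[OF L] continuous_on_subset by blast
  \<comment> \<open>The unknown is u(s) = exp(-a s) (z(s) - x0). Since the weight is absorbed into
    it, the ordinary sup metric on bounded continuous functions does the work of a weighted one;
    \<open>f u\<close> is \<open>g\<close> along the curve recovered from \<open>u\<close>.\<close>
  define f where "f u s = g (x0 + exp (a * s) *\<^sub>R apply_bcontfun u s)" for u and s :: real
  define J where "J u t = integral {0..t} (f u)" for u t
  have f_cont: "continuous_on S (f u)" for u S
    unfolding f_def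
    by (rule continuous_on_compose2[OF g_cont[of UNIV]]) (auto intro!: continuous_intros)
  have f_int: "f u integrable_on {0..t}" for u t
    by (rule integrable_continuous_real) (rule f_cont)
  have J_deriv: "(J u has_vector_derivative f u t) (at t within {0..})" if "t \<ge> 0" for u t
  proof -
    have "((\<lambda>t. integral {0..t} (f u)) has_vector_derivative f u t) (at t within {0..t+1})"
      by (rule integral_has_vector_derivative[OF f_cont]) (use that in auto)
    then show ?thesis
      using at_within_atLeast_eq_Icc[of t "t+1" 0] by (simp add: J_def[abs_def])
  qed
  have J_cont: "continuous_on {0..} (J u)" for u
    by (auto intro!: continuous_on_vector_derivative[OF J_deriv])
  have J_bound: "norm (J u t) \<le> B * t" if "t \<ge> 0" for u t
  proof -
    have "norm (J u t) \<le> integral {0..t} (\<lambda>_. B)"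
      unfolding J_def by (rule integral_norm_bound_integral[OF f_int]) (auto simp: f_def B)
    then show ?thesis using that by (simp add: mult.commute)
  qed
  \<comment> \<open>Elements of the space \<open>bcontfun\<close> live on the whole real line, so
    \<open>max 0 t\<close> extends the weighted integral to negative times by its value at
    0.\<close>
  define Q where "Q u t = exp (- a * max 0 t) *\<^sub>R J u (max 0 t)" for u t
  have Q_bcontfun: "Q u \<in> bcontfun" for u
  proof (rule bcontfun_normI)
    show "continuous_on UNIV (Q u)"
      unfolding Q_def
      by (intro continuous_intros continuous_on_compose2[OF J_cont]) auto
  next
    fix t :: real
    define p where "p = max 0 t"
    have p: "p \<ge> 0" by (simp add: p_def)
    have "norm (Q u t) \<le> exp (- a * p) * (B * p)"
      using J_bound[OF p] by (simp add: Q_def p_def mult_left_mono)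
    \<comment> \<open>With x = a p the last factor is x exp(-x), which is at most 1 because x \<le>
      exp x.\<close>
    also have "\<dots> = B / a * (exp (- (a * p)) * (a * p))"
      using a0 by simp
    also have "\<dots> \<le> B / a * 1"
    proof (rule mult_left_mono)
      have "a * p \<le> exp (a * p)"
        using exp_ge_add_one_self[of "a * p"] by linarith
      then show "exp (- (a * p)) * (a * p) \<le> 1"
        by (simp add: exp_minus field_simps)
    qed (use a0 B0 in auto)
    finally show "norm (Q u t) \<le> B / a" by simp
  qed
  define P where "P u = Bcontfun (Q u)" for u
  have P_apply: "apply_bcontfun (P u) = Q u" for u
    unfolding P_def by (rule Bcontfun_inverse[OF Q_bcontfun])
  have J_lipschitz: "norm (J u t - J w t) \<le> L * dist u w * (exp (a * t) / a)"
    if t: "t \<ge> 0" for u w t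
  proof -
    \<comment> \<open>Undoing the weight costs exp(a s) in the integrand. Integration divides it by
      \<open>a\<close>, and the weight exp(-a t) in \<open>Q\<close> then leaves the factor
      \<open>L / a\<close>.\<close>
    have *: "((\<lambda>s. L * dist u w * exp (a * s)) has_integral
              L * dist u w * (exp (a * t) / a) - L * dist u w * (exp (a * 0) / a)) {0..t}"
      by (rule fundamental_theorem_of_calculus[OF t])
         (use a0 in \<open>auto intro!: derivative_eq_intros
            simp: has_real_derivative_iff_has_vector_derivative[symmetric]\<close>)
    have "norm (J u t - J w t) = norm (integral {0..t} (\<lambda>s. f u s - f w s))"
      by (simp add: J_def integral_diff f_int)
    also have "\<dots> \<le> integral {0..t} (\<lambda>s. L * dist u w * exp (a * s))"
    proof (rule integral_norm_bound_integral)
      show "(\<lambda>s. f u s - f w s) integrable_on {0..t}" by (intro integrable_diff f_int)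
      show "(\<lambda>s. L * dist u w * exp (a * s)) integrable_on {0..t}"
        using * by blast
      fix s
      have "norm (f u s - f w s) \<le> L * dist (x0 + exp (a * s) *\<^sub>R u s) (x0 + exp (a * s) *\<^sub>R w s)"
        unfolding f_def dist_norm[symmetric] by (rule lipschitz_onD[OF L]) auto
      also have "\<dots> = L * (exp (a * s) * dist (u s) (w s))"
        by (simp add: dist_norm flip: scaleR_diff_right)
      also have "\<dots> \<le> L * (exp (a * s) * dist u w)"
        using L0 by (intro mult_left_mono dist_bounded) auto
      finally show "norm (f u s - f w s) \<le> L * dist u w * exp (a * s)" by (simp add: mult_ac)
    qed
    also have "\<dots> = L * dist u w * (exp (a * t) / a) - L * dist u w * (exp (a * 0) / a)"
      using * by (rule integral_unique)
    also have "\<dots> \<le> L * dist u w * (exp (a * t) / a)"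
      using a0 L0 by simp
    finally show ?thesis .
  qed
  have "dist (P u) (P w) \<le> 1 / 2 * dist u w" for u w
  proof (rule dist_bound)
    fix t :: real
    define p where "p = max 0 t"
    have p: "p \<ge> 0" by (simp add: p_def)
    have "dist (P u t) (P w t) = exp (- a * p) * norm (J u p - J w p)"
      by (simp add: P_apply Q_def p_def dist_norm flip: scaleR_diff_right)
    also have "\<dots> \<le> exp (- a * p) * (L * dist u w * (exp (a * p) / a))"
      by (intro mult_left_mono J_lipschitz p) auto
    also have "\<dots> = L / a * dist u w"
      by (simp add: exp_minus)
    also have "\<dots> \<le> 1 / 2 * dist u w"
      by (intro mult_right_mono) (use a0 in \<open>auto simp: a_def field_simps\<close>)
    finally show "dist (P u t) (P w t) \<le> 1 / 2 * dist u w" .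
  qed
  then obtain u where "P u = u"
    using banach_fix_type[of "1/2" P] by auto
  \<comment> \<open>Multiplying the fixed point equation by exp(a t) identifies the curve inside
    \<open>f u\<close> with \<open>x0 + J u t\<close>, which is the integral form of the
    equation.\<close>
  then have u: "exp (a * t) *\<^sub>R u t = J u t" if "t \<ge> 0" for t
    using that P_apply[of u] by (simp add: Q_def max_def exp_minus)
  define z where "z t = x0 + J u t" for t
  have "z 0 = x0" by (simp add: z_def J_def)
  moreover have "(z has_vector_derivative g (z t)) (at t within {0..})" if "t \<ge> 0" for t
  proof -
    have "(z has_vector_derivative f u t) (at t within {0..})"
      unfolding z_def using J_deriv[OF that, of u] by (auto intro!: derivative_eq_intros)
    then show ?thesis using u[OF that] by (simp add: f_def z_def)
  qed
  ultimately show ?thesis by blast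
qed

section \<open>A priori bounds, uniqueness and global existence under linear growth\<close>

lemma gronwall_differential:
  fixes \<phi> \<phi>' :: "real \<Rightarrow> real"
  assumes T: "0 \<le> T"
    and deriv: "\<And>t. 0 \<le> t \<Longrightarrow> t \<le> T \<Longrightarrow> (\<phi> has_real_derivative \<phi>' t) (at t within {0..})"
    and le: "\<And>t. 0 \<le> t \<Longrightarrow> t \<le> T \<Longrightarrow> \<phi>' t \<le> a * \<phi> t"
  shows "\<phi> T \<le> \<phi> 0 * exp (a * T)"
proof -
  \<comment> \<open>Integrating factor: the differential inequality says exactly that the derivative
    of \<open>h\<close> is nonpositive.\<close>
  define h where "h t = \<phi> t * exp (- a * t)" for t
  define h' where "h' t = (\<phi>' t - a * \<phi> t) * exp (- a * t)" for t
  have h: "(h has_real_derivative h' t) (at t within {0..})" if "0 \<le> t" "t \<le> T" for t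
    unfolding h_def h'_def
    by (rule derivative_eq_intros deriv that refl | simp add: algebra_simps)+
  have "h T \<le> h 0"
  proof (rule DERIV_nonpos_imp_decreasing_open[OF T])
    fix t assume t: "0 < t" "t < T"
    \<comment> \<open>At interior times the derivative within the half-line is two-sided; the
      endpoints are covered by continuity of \<open>h\<close>.\<close>
    then have "at t within {0..} = at t"
      by (intro at_within_open_subset[of _ "{0<..}"]) auto
    then have "(h has_real_derivative h' t) (at t)" using h[of t] t by auto
    moreover have "h' t \<le> 0"
      unfolding h'_def using le[of t] t by (intro mult_nonpos_nonneg) auto
    ultimately show "\<exists>y. (h has_real_derivative y) (at t) \<and> y \<le> 0" by blast
  next
    have "(h has_real_derivative h' t) (at t within {0..T})" if "t \<in> {0..T}" for t
      using h[of t] that by (auto intro: DERIV_subset)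
    then show "continuous_on {0..T} h" by (rule DERIV_continuous_on)
  qed
  then show ?thesis by (simp add: h_def exp_minus field_simps)
qed

lemma has_real_derivative_inner_self:
  fixes z :: "real \<Rightarrow> 'a::real_inner"
  assumes "(z has_vector_derivative z') (at t within S)"
  shows "((\<lambda>t. z t \<bullet> z t) has_real_derivative 2 * (z t \<bullet> z')) (at t within S)"
proof -
  have "((\<lambda>t. z t \<bullet> z t) has_derivative (\<lambda>h. z t \<bullet> (h *\<^sub>R z') + (h *\<^sub>R z') \<bullet> z t)) (at t within S)"
    using assms unfolding has_vector_derivative_def by (intro has_derivative_inner)
  moreover have "(\<lambda>h. z t \<bullet> (h *\<^sub>R z') + (h *\<^sub>R z') \<bullet> z t) = (*) (2 * (z t \<bullet> z'))"
    by (auto simp: inner_commute)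
  ultimately show ?thesis by (simp add: has_field_derivative_def)
qed

text \<open>Unlike the norm, its square is differentiable at the origin. Since 2 z . g(z) \<le> 2 C
  |z| (1 + |z|) \<le> 4 C (1 + |z|^2), Gronwall's inequality applies to 1 + |z|^2.\<close>

lemma ode_linear_growth_bound:
  fixes z :: "real \<Rightarrow> 'a::real_inner"
  assumes T: "0 \<le> T" and C: "\<And>x. norm (g x) \<le> C * (1 + norm x)"
    and z: "\<And>t. 0 \<le> t \<Longrightarrow> t \<le> T \<Longrightarrow> (z has_vector_derivative g (z t)) (at t within {0..})"
  shows "1 + (norm (z T))\<^sup>2 \<le> (1 + (norm (z 0))\<^sup>2) * exp (4 * C * T)"
proof -
  have C0: "0 \<le> C" using C[of 0] order_trans[OF norm_ge_zero[of "g 0"]] by simp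
  have "1 + z T \<bullet> z T \<le> (1 + z 0 \<bullet> z 0) * exp (4 * C * T)"
  proof (rule gronwall_differential[OF T])
    fix t assume t: "0 \<le> t" "t \<le> T"
    show "((\<lambda>t. 1 + z t \<bullet> z t) has_real_derivative 2 * (z t \<bullet> g (z t))) (at t within {0..})"
      using has_real_derivative_inner_self[OF z[OF t]] by (auto intro!: derivative_eq_intros)
    define n where "n = norm (z t)"
    have "z t \<bullet> g (z t) \<le> n * (C * (1 + n))"
      unfolding n_def
      by (rule order_trans[OF norm_cauchy_schwarz mult_left_mono[OF C]]) simp
    also have "\<dots> = C * (n * (1 + n))" by simp
    also have "\<dots> \<le> C * (2 * (1 + n\<^sup>2))"
    proof (rule mult_left_mono[OF _ C0])
      have "n = 0 \<or> n > 0" by (auto simp: n_def)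
      moreover have "0 \<le> (n - 1) * (n - 1)" by simp
      ultimately show "n * (1 + n) \<le> 2 * (1 + n\<^sup>2)"
        by (auto simp: power2_eq_square algebra_simps )
    qed
    finally show "2 * (z t \<bullet> g (z t)) \<le> 4 * C * (1 + z t \<bullet> z t)"
      by (simp add: n_def power2_norm_eq_inner algebra_simps)
  qed
  then show ?thesis by (simp add: power2_norm_eq_inner)
qed

text \<open>The squared distance of the two solutions starts at 0 and its derivative is at most 2 L
  times itself.\<close>

lemma ode_lipschitz_unique:
  fixes w z :: "real \<Rightarrow> 'a::real_inner"
  assumes T: "0 \<le> T" and L: "L-lipschitz_on K g"
    and w: "\<And>t. 0 \<le> t \<Longrightarrow> t \<le> T \<Longrightarrow> (w has_vector_derivative g (w t)) (at t within {0..})"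
    and z: "\<And>t. 0 \<le> t \<Longrightarrow> t \<le> T \<Longrightarrow> (z has_vector_derivative g (z t)) (at t within {0..})"
    and K: "\<And>t. 0 \<le> t \<Longrightarrow> t \<le> T \<Longrightarrow> w t \<in> K \<and> z t \<in> K"
    and init: "w 0 = z 0"
  shows "w T = z T"
proof -
  define y where "y t = w t - z t" for t
  have "y T \<bullet> y T \<le> (y 0 \<bullet> y 0) * exp (2 * L * T)"
  proof (rule gronwall_differential[OF T])
    fix t assume t: "0 \<le> t" "t \<le> T"
    have "(y has_vector_derivative g (w t) - g (z t)) (at t within {0..})"
      unfolding y_def using w[OF t] z[OF t] by (rule has_vector_derivative_diff)
    then show "((\<lambda>t. y t \<bullet> y t) has_real_derivative 2 * (y t \<bullet> (g (w t) - g (z t)))) (at t within {0..})"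
      by (rule has_real_derivative_inner_self)
    have "y t \<bullet> (g (w t) - g (z t)) \<le> norm (y t) * norm (g (w t) - g (z t))"
      by (rule norm_cauchy_schwarz)
    also have "\<dots> \<le> norm (y t) * (L * norm (y t))"
      using lipschitz_onD[OF L, of "w t" "z t"] K[OF t]
      by (intro mult_left_mono) (auto simp: y_def dist_norm)
    also have "\<dots> = L * (y t \<bullet> y t)"
      by (simp add: power2_norm_eq_inner[symmetric] power2_eq_square)
    finally show "2 * (y t \<bullet> (g (w t) - g (z t))) \<le> 2 * L * (y t \<bullet> y t)" by simp
  qed
  then have "y T \<bullet> y T \<le> 0" using init by (simp add: y_def)
  then have "y T = 0" by (metis inner_ge_zero inner_eq_zero_iff order_antisym)
  then show ?thesis by (simp add: y_def)
qed

text \<open>Both trajectories over [0, T] are compact, so one Lipschitz constant serves on their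
  union.\<close>

lemma ode_locally_lipschitz_unique:
  fixes w z :: "real \<Rightarrow> 'a::real_inner"
  assumes T: "0 \<le> T" and L: "\<And>K. compact K \<Longrightarrow> \<exists>L. L-lipschitz_on K g"
    and w: "\<And>t. 0 \<le> t \<Longrightarrow> t \<le> T \<Longrightarrow> (w has_vector_derivative g (w t)) (at t within {0..})"
    and z: "\<And>t. 0 \<le> t \<Longrightarrow> t \<le> T \<Longrightarrow> (z has_vector_derivative g (z t)) (at t within {0..})"
    and init: "w 0 = z 0"
  shows "w T = z T"
proof -
  have *: "compact (x ` {0..T})"
    if "\<And>t. 0 \<le> t \<Longrightarrow> t \<le> T \<Longrightarrow> (x has_vector_derivative g (x t)) (at t within {0..})"
    for x :: "real \<Rightarrow> 'a"
    using that
    by (intro compact_continuous_image continuous_on_vector_derivative[of _ _ "\<lambda>t. g (x t)"])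
       (auto intro: has_vector_derivative_within_subset[where S = "{0..}"])
  have "compact (w ` {0..T} \<union> z ` {0..T})" by (intro compact_Un * w z)
  then obtain L where "L-lipschitz_on (w ` {0..T} \<union> z ` {0..T}) g" using L by blast
  then show ?thesis
    by (rule ode_lipschitz_unique[OF T _ w z _ init]) auto
qed

lemma ode_ex_on_bounded_interval:
  fixes g :: "'a::euclidean_space \<Rightarrow> 'a"
  assumes T: "0 \<le> T" and L: "\<And>K. compact K \<Longrightarrow> \<exists>L. L-lipschitz_on K g"
    and C: "\<And>x. norm (g x) \<le> C * (1 + norm x)"
  shows "\<exists>z. z 0 = x0 \<and>
    (\<forall>t. 0 \<le> t \<and> t \<le> T \<longrightarrow> (z has_vector_derivative g (z t)) (at t within {0..}))"
proof -
  have C0: "0 \<le> C" using C[of 0] order_trans[OF norm_ge_zero[of "g 0"]] by simp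
  \<comment> \<open>This is the a priori bound of \<open>ode_linear_growth_bound\<close> at time
    \<open>T\<close> for the initial value \<open>x0\<close>.\<close>
  define R where "R = sqrt ((1 + (norm x0)\<^sup>2) * exp (4 * C * T))"
  have R0: "0 \<le> R" by (simp add: R_def)
  define S where "S = cball (0::'a) R"
  define p where "p = closest_point S"
  have S: "convex S" "closed S" "S \<noteq> {}" "0 \<in> S" using R0 by (auto simp: S_def)
  have p_in: "p x \<in> S" for x unfolding p_def using S by (intro closest_point_in_set) auto
  have p_id: "p x = x" if "x \<in> S" for x unfolding p_def by (rule closest_point_self[OF that])
  have p_lip: "dist (p x) (p y) \<le> dist x y" for x y
    unfolding p_def by (rule closest_point_lipschitz) (use S in auto)
  have p_norm: "norm (p x) \<le> norm x" for x
    using p_lip[of x 0] p_id[of 0] S by simp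
  obtain M where M: "M-lipschitz_on S g" using L[of S] by (auto simp: S_def)
  have gp_lip: "M-lipschitz_on UNIV (\<lambda>x. g (p x))"
  proof (rule lipschitz_onI)
    fix x y
    have "dist (g (p x)) (g (p y)) \<le> M * dist (p x) (p y)"
      by (rule lipschitz_onD[OF M p_in p_in])
    also have "\<dots> \<le> M * dist x y"
      by (intro mult_left_mono p_lip lipschitz_on_nonneg[OF M])
    finally show "dist (g (p x)) (g (p y)) \<le> M * dist x y" .
  qed (rule lipschitz_on_nonneg[OF M])
  have gp_bound: "norm (g (p x)) \<le> C * (1 + R)" for x
    using C[of "p x"] p_in[of x] mult_left_mono[OF _ C0, of "1 + norm (p x)" "1 + R"]
    by (auto simp: S_def)
  \<comment> \<open>As \<open>p\<close> fixes 0 and is nonexpansive, it does not increase norms.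
    Hence the truncated field grows linearly with the same \<open>C\<close>, and the radius
    \<open>R\<close> also confines its solutions up to time \<open>T\<close>.\<close>
  have gp_growth: "norm (g (p x)) \<le> C * (1 + norm x)" for x
    using C[of "p x"] mult_left_mono[OF _ C0, of "1 + norm (p x)" "1 + norm x"] p_norm[of x]
    by auto
  obtain z where z0: "z 0 = x0"
    and z: "\<And>t. t \<ge> 0 \<Longrightarrow> (z has_vector_derivative g (p (z t))) (at t within {0..})"
    using lipschitz_bounded_ode_ex[OF gp_lip gp_bound, of x0] by blast
  have "p (z t) = z t" if t: "0 \<le> t" "t \<le> T" for t
  proof -
    have "1 + (norm (z t))\<^sup>2 \<le> (1 + (norm (z 0))\<^sup>2) * exp (4 * C * t)"
      by (rule ode_linear_growth_bound[OF t(1) gp_growth z])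
    also have "\<dots> \<le> (1 + (norm x0)\<^sup>2) * exp (4 * C * T)"
      unfolding z0 using C0 t by (intro mult_left_mono) (auto intro: mult_left_mono)
    finally have "(norm (z t))\<^sup>2 \<le> (1 + (norm x0)\<^sup>2) * exp (4 * C * T)" by linarith
    then have "norm (z t) \<le> R" unfolding R_def by (rule real_le_rsqrt)
    then show ?thesis by (intro p_id) (simp add: S_def)
  qed
  then have "(z has_vector_derivative g (z t)) (at t within {0..})" if "0 \<le> t" "t \<le> T" for t
    using z[of t] that by simp
  with z0 show ?thesis by blast
qed

text \<open>The truncation radius depends on the time horizon, so a solution is chosen for each
  horizon \<open>T\<close>; by uniqueness these agree where they overlap and can be glued.\<close>

theorem ode_global_ex:
  fixes g :: "'a::euclidean_space \<Rightarrow> 'a"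
  assumes L: "\<And>K. compact K \<Longrightarrow> \<exists>L. L-lipschitz_on K g"
    and C: "\<And>x. norm (g x) \<le> C * (1 + norm x)"
  shows "\<exists>z. z 0 = x0 \<and> (\<forall>t\<ge>0. (z has_vector_derivative g (z t)) (at t within {0..}))"
proof -
  define sol where "sol T z \<longleftrightarrow> z 0 = x0 \<and>
    (\<forall>t. 0 \<le> t \<and> t \<le> T \<longrightarrow> (z has_vector_derivative g (z t)) (at t within {0..}))"
    for T :: real and z
  define Z where "Z T = (SOME z. sol T z)" for T
  have Z: "sol T (Z T)" if "T \<ge> 0" for T
    unfolding Z_def using ode_ex_on_bounded_interval[OF that L C, of x0]
    by (intro someI_ex[of "sol T"]) (simp add: sol_def)
  have Z_eq: "Z T s = Z U s" if "0 \<le> s" "s \<le> T" "s \<le> U" for T U s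
    by (rule ode_locally_lipschitz_unique[OF _ L]) (use Z[of T] Z[of U] that in \<open>auto simp: sol_def\<close>)
  define z where "z t = Z t t" for t
  have z_eq: "z s = Z T s" if "0 \<le> s" "s \<le> T" for s T
    unfolding z_def using that by (intro Z_eq) auto
  have "(z has_vector_derivative g (z t)) (at t within {0..})" if t: "t \<ge> 0" for t
  proof -
    \<comment> \<open>The horizon \<open>t + 1\<close> instead of \<open>t\<close> makes
      \<open>z\<close> agree with a single solution on a neighbourhood of \<open>t\<close> in the
      half-line, as the derivative at \<open>t\<close> requires.\<close>
    have "(Z (t + 1) has_vector_derivative g (z t)) (at t within {0..})"
      using Z[of "t + 1"] z_eq[of t "t + 1"] t by (auto simp: sol_def)
    then have "(Z (t + 1) has_vector_derivative g (z t)) (at t within {0..t + 1})"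
      using at_within_atLeast_eq_Icc[of t "t + 1" 0] by simp
    then have "(z has_vector_derivative g (z t)) (at t within {0..t + 1})"
      by (rule has_vector_derivative_transform[rotated 2]) (use t z_eq in auto)
    then show ?thesis using at_within_atLeast_eq_Icc[of t "t + 1" 0] by simp
  qed
  moreover have "z 0 = x0" using Z[of 0] by (simp add: z_def sol_def)
  ultimately show ?thesis by blast
qed

section \<open>Gradients and antisymmetric double sums\<close>

lemma GDERIV_unique:
  assumes "GDERIV f x :> D" and "GDERIV f x :> E"
  shows "D = E"
proof -
  have "(\<lambda>h. h \<bullet> D) = (\<lambda>h. h \<bullet> E)"
    using assms unfolding gderiv_def by (rule has_derivative_unique)
  then have "h \<bullet> D = h \<bullet> E" for h by meson
  then show ?thesis by (metis inner_commute vector_eq_ldot)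
qed

text \<open>Riesz representation in coordinates: the values of the derivative on the basis are the
  coordinates of the gradient, and \<open>GDERIV_unique\<close> makes the definite description in
  \<open>grad\<close> denote it.\<close>

lemma GDERIV_grad:
  fixes f :: "'a::euclidean_space \<Rightarrow> real"
  assumes "f differentiable (at x)"
  shows "GDERIV f x :> grad f x"
proof -
  obtain f' where f': "(f has_derivative f') (at x)"
    using assms by (auto simp: differentiable_def)
  then interpret f': linear f' by (rule has_derivative_linear)
  define D where "D = (\<Sum>b\<in>Basis. f' b *\<^sub>R b)"
  have "f' h = h \<bullet> D" for h
  proof -
    have "f' h = f' (\<Sum>b\<in>Basis. (h \<bullet> b) *\<^sub>R b)" by (simp add: euclidean_representation)
    also have "\<dots> = h \<bullet> D" by (simp add: f'.sum f'.scale D_def inner_sum_right mult.commute)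
    finally show ?thesis .
  qed
  then have "f' = (\<lambda>h. h \<bullet> D)" by blast
  then have D: "GDERIV f x :> D" using f' by (simp add: gderiv_def)
  then show ?thesis
    unfolding grad_def by (rule theI) (rule GDERIV_unique[OF _ D])
qed

lemma grad_eqI:
  assumes "GDERIV f x :> D"
  shows "grad f x = D"
  unfolding grad_def using assms by (rule the_equality) (rule GDERIV_unique[OF _ assms])

text \<open>Exchanging i and j turns the part with \<open>h j\<close> into minus the part with
  \<open>h i\<close>. This serves both the pair potentials of the Hamiltonian and the quadratic form
  of \<open>Psi\<close>.\<close>

lemma sum_inner_antisymmetric:
  fixes a :: "'n::finite \<Rightarrow> 'n \<Rightarrow> 'a::real_inner"
  assumes "\<And>i j. a i j = - a j i"
  shows "(\<Sum>i\<in>UNIV. \<Sum>j\<in>UNIV. (h i - h j) \<bullet> a i j) = 2 * (\<Sum>i\<in>UNIV. \<Sum>j\<in>UNIV. h i \<bullet> a i j)"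
proof -
  have "(\<Sum>i\<in>UNIV. \<Sum>j\<in>UNIV. h j \<bullet> a i j) = (\<Sum>j\<in>UNIV. \<Sum>i\<in>UNIV. h j \<bullet> a i j)"
    by (rule sum.swap)
  also have "\<dots> = (\<Sum>j\<in>UNIV. \<Sum>i\<in>UNIV. - (h j \<bullet> a j i))"
    by (intro sum.cong refl) (metis assms inner_minus_right)
  also have "\<dots> = - (\<Sum>i\<in>UNIV. \<Sum>j\<in>UNIV. h i \<bullet> a i j)" by (simp add: sum_negf)
  finally show ?thesis by (simp add: inner_diff_left sum_subtractf)
qed

text \<open>Exchanging the indices shows that the sum is its own negative.\<close>

lemma sum_antisymmetric:
  fixes a :: "'n::finite \<Rightarrow> 'n \<Rightarrow> 'a::real_vector"
  assumes "\<And>i j. a i j = - a j i"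
  shows "(\<Sum>i\<in>UNIV. \<Sum>j\<in>UNIV. a i j) = 0"
proof -
  have "(\<Sum>i\<in>UNIV. \<Sum>j\<in>UNIV. a i j) = (\<Sum>j\<in>UNIV. \<Sum>i\<in>UNIV. a i j)" by (rule sum.swap)
  also have "\<dots> = (\<Sum>j\<in>UNIV. \<Sum>i\<in>UNIV. - a j i)"
    by (intro sum.cong refl) (metis assms)
  also have "\<dots> = - (\<Sum>i\<in>UNIV. \<Sum>j\<in>UNIV. a i j)" by (simp add: sum_negf)
  finally have "2 *\<^sub>R (\<Sum>i\<in>UNIV. \<Sum>j\<in>UNIV. a i j) = 0"
    by (metis add.right_inverse scaleR_2)
  then show ?thesis by simp
qed

section \<open>The gradient of the Hamiltonian and the quadratic form of \<open>Psi\<close>\<close>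

lemma GDERIV_hamiltonian:
  fixes V :: "real^'d \<Rightarrow> real" and z :: "('d::finite, 'n::finite) state"
  assumes diff: "\<And>x. V differentiable (at x)" and odd: "\<And>x. grad V (- x) = - grad V x"
  shows "GDERIV (hamiltonian V c) z :>
    (\<chi> i. (1 / real CARD('n)) *\<^sub>R (\<Sum>j\<in>UNIV. grad V (fst z $ i - fst z $ j)), centred c (snd z))"
proof -
  define q where "q = 1 / real CARD('n)"
  define a where "a i j = grad V (fst z $ i - fst z $ j)" for i j
  have V: "((\<lambda>z :: ('d, 'n) state. V (fst z $ i - fst z $ j)) has_derivative
      (\<lambda>h. (fst h $ i - fst h $ j) \<bullet> a i j)) (at z)" for i j
    by (rule has_derivative_compose[where f = "\<lambda>z. fst z $ i - fst z $ j"
          and g = V and g' = "\<lambda>h. h \<bullet> a i j"])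
       (auto intro!: derivative_eq_intros bounded_linear.has_derivative[OF bounded_linear_vec_nth]
          GDERIV_grad[OF diff, unfolded gderiv_def] simp: a_def)
  have K: "((\<lambda>z :: ('d, 'n) state. (snd z $ i - c) \<bullet> (snd z $ i - c)) has_derivative
      (\<lambda>h. 2 * (snd h $ i \<bullet> (snd z $ i - c)))) (at z)" for i
    by (auto intro!: derivative_eq_intros bounded_linear.has_derivative[OF bounded_linear_vec_nth]
        simp: inner_commute)
  have H: "hamiltonian V c = (\<lambda>z :: ('d, 'n) state. 1 / 2 * (\<Sum>i\<in>UNIV. (snd z $ i - c) \<bullet> (snd z $ i - c)
                 + q * (\<Sum>j\<in>UNIV. V (fst z $ i - fst z $ j))))"
    by (auto simp: hamiltonian_def q_def fun_eq_iff)
  \<comment> \<open>Each particle occurs in both slots of the double sum of potentials. Antisymmetry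
    makes the two contributions equal, and the resulting factor 2 cancels the 1/2 in the
    Hamiltonian.\<close>
  have a_anti: "a i j = - a j i" for i j
    using odd[of "fst z $ j - fst z $ i"] by (simp add: a_def)
  have "(hamiltonian V c has_derivative (\<lambda>h. 1 / 2 * (\<Sum>i\<in>UNIV. 2 * (snd h $ i \<bullet> (snd z $ i - c))
          + q * (\<Sum>j\<in>UNIV. (fst h $ i - fst h $ j) \<bullet> a i j)))) (at z)"
    unfolding H
    by (intro has_derivative_mult_right has_derivative_sum has_derivative_add K V)
  moreover have "1 / 2 * (\<Sum>i\<in>UNIV. 2 * (snd h $ i \<bullet> (snd z $ i - c))
          + q * (\<Sum>j\<in>UNIV. (fst h $ i - fst h $ j) \<bullet> a i j))
      = h \<bullet> (\<chi> i. q *\<^sub>R (\<Sum>j\<in>UNIV. a i j), centred c (snd z))" for h :: "('d, 'n) state"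
  proof -
    have "(\<Sum>i\<in>UNIV. q * (\<Sum>j\<in>UNIV. (fst h $ i - fst h $ j) \<bullet> a i j))
        = q * (2 * (\<Sum>i\<in>UNIV. \<Sum>j\<in>UNIV. fst h $ i \<bullet> a i j))"
      unfolding sum_distrib_left[symmetric] using sum_inner_antisymmetric[OF a_anti, of "\<lambda>i. fst h $ i"]
      by simp
    moreover have "(\<Sum>i\<in>UNIV. 2 * (snd h $ i \<bullet> (snd z $ i - c))) = 2 * (snd h \<bullet> centred c (snd z))"
      by (simp add: sum_distrib_left inner_vec_def centred_def)
    moreover have "fst h \<bullet> (\<chi> i. q *\<^sub>R (\<Sum>j\<in>UNIV. a i j)) = q * (\<Sum>i\<in>UNIV. \<Sum>j\<in>UNIV. fst h $ i \<bullet> a i j)"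
      by (simp add: inner_vec_def[of "fst h"] inner_sum_right sum_distrib_left)
    ultimately show ?thesis
      by (cases h) (simp add: sum.distrib)
  qed
  ultimately show ?thesis by (simp add: gderiv_def a_def q_def)
qed

text \<open>\<open>Psi\<close> is a graph Laplacian with edge weights \<open>\<psi>\<close> / N: its
  rows sum to zero, so it acts through differences of entries.\<close>

lemma Psi_apply:
  fixes y :: "('d::finite, 'n::finite) config"
  shows "(Psi \<psi> (r, w) ** y) $ i
    = (1 / real CARD('n)) *\<^sub>R (\<Sum>j\<in>UNIV. \<psi> (norm (r $ j - r $ i)) *\<^sub>R (y $ i - y $ j))"
proof -
  define q where "q = 1 / real CARD('n)"
  define b where "b j = \<psi> (norm (r $ j - r $ i))" for j
  have "(Psi \<psi> (r, w) ** y) $ i = (\<Sum>k\<in>UNIV. Psi \<psi> (r, w) $ i $ k *\<^sub>R y $ k)"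
    by (simp add: vec_eq_iff matrix_matrix_mult_def)
  also have "\<dots> = Psi \<psi> (r, w) $ i $ i *\<^sub>R y $ i + (\<Sum>k\<in>UNIV - {i}. Psi \<psi> (r, w) $ i $ k *\<^sub>R y $ k)"
    by (subst sum.remove[of _ i]) auto
  also have "\<dots> = (q * (\<Sum>k\<in>UNIV - {i}. b k)) *\<^sub>R y $ i + (\<Sum>k\<in>UNIV - {i}. - (q * b k) *\<^sub>R y $ k)"
    by (auto simp: Psi_def q_def b_def intro!: sum.cong)
  also have "\<dots> = q *\<^sub>R (\<Sum>k\<in>UNIV - {i}. b k *\<^sub>R (y $ i - y $ k))"
    by (simp add: scaleR_sum_right scaleR_sum_left sum_distrib_left sum_subtractf scaleR_diff_right
        sum_negf)
  \<comment> \<open>The excluded index contributes a zero difference and may be put back.\<close>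
  also have "(\<Sum>k\<in>UNIV - {i}. b k *\<^sub>R (y $ i - y $ k)) = (\<Sum>k\<in>UNIV. b k *\<^sub>R (y $ i - y $ k))"
    by (subst (2) sum.remove[of _ i]) auto
  finally show ?thesis by (simp add: q_def b_def)
qed

lemma Psi_nonneg:
  fixes u :: "('d::finite, 'n::finite) config"
  assumes "\<And>s. \<psi> s \<ge> 0"
  shows "u \<bullet> (Psi \<psi> z ** u) \<ge> 0"
proof -
  obtain r w where z: "z = (r, w)" by (cases z)
  define a where "a i j = \<psi> (norm (r $ j - r $ i)) *\<^sub>R (u $ i - u $ j)" for i j
  have a_anti: "a i j = - a j i" for i j
    by (simp add: a_def norm_minus_commute flip: scaleR_minus_right)
  have "u \<bullet> (Psi \<psi> z ** u) = (1 / real CARD('n)) * (\<Sum>i\<in>UNIV. \<Sum>j\<in>UNIV. u $ i \<bullet> a i j)"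
    by (simp add: inner_vec_def[of u] z Psi_apply a_def inner_sum_right sum_distrib_left)
  \<comment> \<open>Symmetrizing turns every summand into a nonnegative weight times the squared
    norm of \<open>u $ i - u $ j\<close>.\<close>
  also have "\<dots> = (1 / real CARD('n)) * (1 / 2 * (\<Sum>i\<in>UNIV. \<Sum>j\<in>UNIV. (u $ i - u $ j) \<bullet> a i j))"
    using sum_inner_antisymmetric[OF a_anti, of "\<lambda>i. u $ i"] by simp
  also have "\<dots> \<ge> 0"
    by (intro mult_nonneg_nonneg sum_nonneg) (auto simp: a_def assms)
  finally show ?thesis .
qed

section \<open>The port-Hamiltonian field in terms of the forces\<close>

lemma ph_field_eq_grad:
  assumes "GDERIV (hamiltonian V c) z :> (gr, gv)"
  shows "ph_field \<psi> V c z = (gv, - gr - Psi \<psi> z ** gv)"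
proof -
  have neg_mat: "(- mat 1 :: real^'n^'n) ** x = - x" for x :: "real^'d^'n"
    by (simp add: vec_eq_iff matrix_matrix_mult_def mat_def if_distrib if_distribR sum_negf
        cong: if_cong)
  show ?thesis
    by (simp add: ph_field_def block_apply_def grad_eqI[OF assms] matrix_mul_lid neg_mat)
qed

text \<open>Subtracting the common vector \<open>c\<close> leaves velocity differences unchanged, so
  \<open>Psi\<close> applied to the centred velocities is minus the alignment force. In this form
  the regularity and growth assumptions on \<open>force\<close> become available.\<close>

lemma ph_field_eq_force:
  fixes V :: "real^'d \<Rightarrow> real" and z :: "('d::finite, 'n::finite) state"
  assumes "\<And>x. V differentiable (at x)" and "\<And>x. grad V (- x) = - grad V x"
  shows "ph_field \<psi> V c z = (centred c (snd z), \<chi> i. force \<psi> V i 0 (fst z) (snd z))"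
proof -
  obtain r v where z: "z = (r, v)" by (cases z)
  define q where "q = 1 / real CARD('n)"
  have "(\<Sum>j\<in>UNIV. \<psi> (norm (r $ j - r $ i)) *\<^sub>R (v $ j - v $ i))
      = - (\<Sum>j\<in>UNIV. \<psi> (norm (r $ j - r $ i)) *\<^sub>R (centred c v $ i - centred c v $ j))" for i
    by (simp add: centred_def sum_negf[symmetric] scaleR_diff_right)
  then have "- (Psi \<psi> (r, v) ** centred c v) $ i
      = q *\<^sub>R (\<Sum>j\<in>UNIV. \<psi> (norm (r $ j - r $ i)) *\<^sub>R (v $ j - v $ i))" for i
    by (simp only: Psi_apply q_def scaleR_minus_right)
  then show ?thesis
    unfolding ph_field_eq_grad[OF GDERIV_hamiltonian[OF assms]] prod.inject vec_eq_iff z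
    by (auto simp: force_def simp flip: q_def)
qed

text \<open>Newton's third law holds for both parts: the alignment weights are symmetric while
  velocity differences change sign, and \<open>grad V\<close> is odd.\<close>

lemma sum_force_eq_0:
  assumes odd: "\<And>x. grad V (- x) = - grad V x"
  shows "(\<Sum>i\<in>UNIV. force \<psi> V i t x v) = 0"
proof -
  have "(\<Sum>i\<in>UNIV. \<Sum>j\<in>UNIV. \<psi> (norm (x $ j - x $ i)) *\<^sub>R (v $ j - v $ i)) = 0"
    by (rule sum_antisymmetric) (simp add: norm_minus_commute flip: scaleR_minus_right)
  moreover have "(\<Sum>i\<in>UNIV. \<Sum>j\<in>UNIV. grad V (x $ i - x $ j)) = 0"
    by (rule sum_antisymmetric) (metis odd minus_diff_eq)
  ultimately show ?thesis
    by (simp add: force_def sum_subtractf flip: scaleR_sum_right)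
qed

section \<open>Lipschitz and growth estimates for the field\<close>

lemma norm_vec_le_sum:
  fixes x :: "('a::real_normed_vector)^'n::finite"
  shows "norm x \<le> (\<Sum>i\<in>UNIV. norm (x $ i))"
  unfolding norm_vec_def by (rule L2_set_le_sum) simp

text \<open>The factor \<open>CARD('n)\<close> comes from bounding the Euclidean norm by the sum of
  the norms of the entries.\<close>

lemma lipschitz_on_vec_lambda:
  fixes f :: "'n::finite \<Rightarrow> 'a::metric_space \<Rightarrow> 'b::real_normed_vector"
  assumes "\<And>i. L-lipschitz_on K (f i)"
  shows "(real CARD('n) * L)-lipschitz_on K (\<lambda>x. \<chi> i. f i x)"
proof (rule lipschitz_onI)
  fix x y assume xy: "x \<in> K" "y \<in> K"
  have "dist (\<chi> i. f i x) (\<chi> i. f i y) \<le> (\<Sum>i\<in>UNIV. dist (f i x) (f i y))"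
    using norm_vec_le_sum[of "(\<chi> i. f i x) - (\<chi> i. f i y)"] by (simp add: dist_norm)
  also have "\<dots> \<le> (\<Sum>i\<in>(UNIV :: 'n set). L * dist x y)"
    by (intro sum_mono lipschitz_onD[OF assms] xy)
  finally show "dist (\<chi> i. f i x) (\<chi> i. f i y) \<le> real CARD('n) * L * dist x y" by simp
qed (use lipschitz_on_nonneg[OF assms] in simp)

lemma lipschitz_on_centred_snd:
  fixes K :: "('d::finite, 'n::finite) state set"
  shows "1-lipschitz_on K (\<lambda>z. centred c (snd z))"
proof (rule lipschitz_onI)
  fix x y :: "('d, 'n) state"
  have "dist (centred c (snd x)) (centred c (snd y)) = dist (snd x) (snd y)"
    by (simp add: centred_def dist_norm)
  then show "dist (centred c (snd x)) (centred c (snd y)) \<le> 1 * dist x y"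
    using dist_snd_le[of x y] by simp
qed simp

lemma lipschitz_on_ph_field:
  fixes V :: "real^'d \<Rightarrow> real" and K :: "('d::finite, 'n::finite) state set"
  assumes V: "\<And>x. V differentiable (at x)" "\<And>x. grad V (- x) = - grad V x"
    and L: "\<And>i. L-lipschitz_on K (\<lambda>(x, v). force \<psi> V i 0 x v)"
  shows "\<exists>M. M-lipschitz_on K (ph_field \<psi> V c)"
proof -
  have "(real CARD('n) * L)-lipschitz_on K (\<lambda>z. \<chi> i. force \<psi> V i 0 (fst z) (snd z))"
    by (rule lipschitz_on_vec_lambda) (use L in \<open>simp add: case_prod_unfold\<close>)
  then have "\<exists>M. M-lipschitz_on K
      (\<lambda>z. (centred c (snd z), \<chi> i. force \<psi> V i 0 (fst z) (snd z)))"
    using lipschitz_on_Pair[OF lipschitz_on_centred_snd] by blast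
  then show ?thesis by (simp add: ph_field_eq_force[OF V, abs_def])
qed

lemma ph_field_linear_growth:
  fixes V :: "real^'d \<Rightarrow> real" and z :: "('d::finite, 'n::finite) state"
  assumes V: "\<And>x. V differentiable (at x)" "\<And>x. grad V (- x) = - grad V x"
    and C0: "0 \<le> C"
    and C: "\<And>(i::'n) x v. norm (force \<psi> V i 0 x v) \<le> C * (1 + norm x + norm v)"
  shows "norm (ph_field \<psi> V c z)
    \<le> (1 + norm (\<chi> i::'n. c) + 2 * (real CARD('n) * C)) * (1 + norm z)"
proof -
  obtain r v where z: "z = (r, v)" by (cases z)
  define D where "D = real CARD('n) * C"
  have D0: "0 \<le> D" using C0 by (simp add: D_def)
  have r: "norm r \<le> norm z" and v: "norm v \<le> norm z"
    unfolding z by (rule norm_fst_le, rule norm_snd_le)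
  have "norm (\<chi> i. force \<psi> V i 0 r v) \<le> (\<Sum>i\<in>(UNIV::'n set). C * (1 + norm r + norm v))"
    by (rule order_trans[OF norm_vec_le_sum sum_mono]) (simp add: C)
  also have "\<dots> = D * (1 + norm r + norm v)" by (simp add: D_def)
  \<comment> \<open>Positions and velocities are each bounded by the norm of the state, so the
    bracket is at most 1 + 2 |z|.\<close>
  also have "\<dots> \<le> D * (2 * (1 + norm z))"
    using r v by (intro mult_left_mono D0) auto
  finally have F: "norm (\<chi> i. force \<psi> V i 0 r v) \<le> 2 * D * (1 + norm z)"
    by (simp add: algebra_simps)
  have "norm (centred c v) \<le> norm v + norm (\<chi> i::'n. c)"
    unfolding centred_def by (rule norm_triangle_ineq4)
  also have "\<dots> \<le> (1 + norm (\<chi> i::'n. c)) * (1 + norm z)"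
    using v mult_nonneg_nonneg[OF norm_ge_zero[of "\<chi> i::'n. c"] norm_ge_zero[of z]]
    unfolding distrib_left distrib_right mult_1_left mult_1_right by linarith
  finally have "norm (centred c v) \<le> (1 + norm (\<chi> i::'n. c)) * (1 + norm z)" .
  moreover have "norm (ph_field \<psi> V c z) \<le> norm (centred c v) + norm (\<chi> i. force \<psi> V i 0 r v)"
    unfolding ph_field_eq_force[OF V] z by (simp add: norm_Pair_le)
  ultimately show ?thesis using F unfolding D_def[symmetric] by (simp add: distrib_right)
qed

section \<open>Energy dissipation and conservation of the mean velocity\<close>

lemma hamiltonian_has_real_derivative:
  fixes V :: "real^'d \<Rightarrow> real" and z :: "real \<Rightarrow> ('d::finite, 'n::finite) state"
  assumes V: "\<And>x. V differentiable (at x)" "\<And>x. grad V (- x) = - grad V x"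
    and z: "(z has_vector_derivative ph_field \<psi> V c (z t)) (at t within S)"
  shows "((\<lambda>s. hamiltonian V c (z s)) has_real_derivative
      - (centred c (snd (z t)) \<bullet> (Psi \<psi> (z t) ** centred c (snd (z t))))) (at t within S)"
proof -
  define u where "u = centred c (snd (z t))"
  \<comment> \<open>Only the velocity component \<open>u\<close> of the gradient has to be known:
    \<open>gr\<close> enters the pairing below as u . gr - gr . u and cancels.\<close>
  obtain gr where H: "GDERIV (hamiltonian V c) (z t) :> (gr, u)"
    using GDERIV_hamiltonian[OF V, where z = "z t"] unfolding u_def by blast
  have "((\<lambda>s. hamiltonian V c (z s)) has_derivative
      (\<lambda>h. (h *\<^sub>R ph_field \<psi> V c (z t)) \<bullet> (gr, u))) (at t within S)"
    by (rule has_derivative_compose[OF z[unfolded has_vector_derivative_def] H[unfolded gderiv_def]])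
  moreover have "ph_field \<psi> V c (z t) \<bullet> (gr, u) = - (u \<bullet> (Psi \<psi> (z t) ** u))"
    unfolding ph_field_eq_grad[OF H] by (simp add: inner_diff_right inner_commute[of _ u])
  then have "(\<lambda>h. (h *\<^sub>R ph_field \<psi> V c (z t)) \<bullet> (gr, u)) = (*) (- (u \<bullet> (Psi \<psi> (z t) ** u)))"
    by (auto simp only: inner_scaleR_left mult.commute)
  ultimately show ?thesis
    by (simp only: has_field_derivative_def u_def)
qed

text \<open>The mean velocity is a linear function of the state, so its derivative is the average
  force. Here \<open>c\<close> is any fixed vector, so conservation is not presupposed.\<close>

lemma mean_velocity_has_vector_derivative_0:
  fixes V :: "real^'d \<Rightarrow> real" and z :: "real \<Rightarrow> ('d::finite, 'n::finite) state"
  assumes V: "\<And>x. V differentiable (at x)" "\<And>x. grad V (- x) = - grad V x"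
    and z: "(z has_vector_derivative ph_field \<psi> V c (z t)) (at t within S)"
  shows "((\<lambda>s. mean_velocity (snd (z s))) has_vector_derivative 0) (at t within S)"
proof -
  have lin: "bounded_linear (\<lambda>z :: ('d, 'n) state. mean_velocity (snd z))"
    unfolding mean_velocity_def
    by (intro bounded_linear_intros bounded_linear_compose[OF bounded_linear_vec_nth])
  have "mean_velocity (snd (ph_field \<psi> V c (z t))) = 0"
    by (simp add: ph_field_eq_force[OF V] mean_velocity_def sum_force_eq_0[OF V(2)])
  then show ?thesis using bounded_linear.has_vector_derivative[OF lin z] by simp
qed

theorem theorem3p1:
  fixes \<psi> :: "real \<Rightarrow> real"
    and V :: "real^'d \<Rightarrow> real"
    and z0 :: "('d::finite, 'n::finite) state"
  assumes "CARD('n) \<ge> 2"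
    and "\<And>s. \<psi> s \<ge> 0"
    and "\<And>x. V differentiable (at x)"
    and "continuous_on UNIV (grad V)"
    and "\<And>x. grad V (- x) = - grad V x"
    and "\<And>i::'n. continuous_on UNIV (\<lambda>(t, x, v). force \<psi> V i t x v)"
    and "\<exists>C>0. \<forall>(i::'n) t x v. norm (force \<psi> V i t x v) \<le> C * (1 + norm x + norm v)"
    and "\<And>K :: ('d, 'n) state set. compact K \<Longrightarrow>
           \<exists>L>0. \<forall>i t. L-lipschitz_on K (\<lambda>(x, v). force \<psi> V i t x v)"
  shows "\<exists>z. global_solution \<psi> V z0 z
      \<and> (\<forall>w. global_solution \<psi> V z0 w \<longrightarrow> (\<forall>t\<ge>0. w t = z t))
      \<and> (let c = mean_velocity (snd (z 0)); u = (\<lambda>t. centred c (snd (z t))) in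
           (\<forall>t\<ge>0. ((\<lambda>s. hamiltonian V c (z s)) has_real_derivative
                      - (u t \<bullet> (Psi \<psi> (z t) ** u t))) (at t within {0..})
                 \<and> - (u t \<bullet> (Psi \<psi> (z t) ** u t)) \<le> 0)
         \<and> (\<forall>t\<ge>0. c = mean_velocity (snd (z t))))"
proof -
  note V = assms(3,5)
  \<comment> \<open>Every candidate solution starts at \<open>z0\<close>, so all of them have this
    same mean and solve one autonomous equation with the field \<open>g\<close>.\<close>
  define c where "c = mean_velocity (snd z0)"
  define g :: "('d, 'n) state \<Rightarrow> ('d, 'n) state" where "g = ph_field \<psi> V c"
  have lip: "\<exists>L. L-lipschitz_on K g" if K: "compact K" for K
    using assms(8)[OF K] lipschitz_on_ph_field[OF V] unfolding g_def by metis
  obtain C where C0: "C > 0"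
    and C: "\<And>(i::'n) t x v. norm (force \<psi> V i t x v) \<le> C * (1 + norm x + norm v)"
    using assms(7) by blast
  have growth: "norm (g z) \<le> (1 + norm (\<chi> i::'n. c) + 2 * (real CARD('n) * C)) * (1 + norm z)" for z
    unfolding g_def by (rule ph_field_linear_growth[OF V less_imp_le[OF C0] C])
  obtain z where z0: "z 0 = z0"
    and z: "\<And>t. t \<ge> 0 \<Longrightarrow> (z has_vector_derivative g (z t)) (at t within {0..})"
    using ode_global_ex[OF lip growth, of z0] by blast
  have sol: "global_solution \<psi> V z0 z"
    using z z0 by (simp add: global_solution_def g_def c_def)
  have unique: "w t = z t" if w: "global_solution \<psi> V z0 w" and t: "t \<ge> 0" for w t
    by (rule ode_locally_lipschitz_unique[OF t lip _ z])
       (use w z0 in \<open>auto simp: global_solution_def g_def c_def\<close>)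
  have mean: "mean_velocity (snd (z t)) = c" if "t \<ge> 0" for t
  proof -
    \<comment> \<open>A vanishing derivative on the convex half-line forces a constant, whose value
      is read off at time 0.\<close>
    have "((\<lambda>s. mean_velocity (snd (z s))) has_derivative (\<lambda>h. 0)) (at s within {0..})"
      if "s \<in> {0..}" for s
      using mean_velocity_has_vector_derivative_0[OF V z[unfolded g_def]] that
      by (simp add: has_vector_derivative_def)
    then obtain k where "\<And>s. s \<in> {0..} \<Longrightarrow> mean_velocity (snd (z s)) = k"
      using has_derivative_zero_constant[of "{0::real..}" "\<lambda>s. mean_velocity (snd (z s))"]
      by (meson convex_real_interval(1))
    from this[of t] this[of 0] that show ?thesis by (simp add: z0 c_def)
  qed
  have energy: "((\<lambda>s. hamiltonian V c (z s)) has_real_derivative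
      - (centred c (snd (z t)) \<bullet> (Psi \<psi> (z t) ** centred c (snd (z t))))) (at t within {0..})"
    if "t \<ge> 0" for t
    using hamiltonian_has_real_derivative[OF V z[unfolded g_def, OF that]] .
  have c: "mean_velocity (snd (z 0)) = c" by (simp add: z0 c_def)
  show ?thesis
  proof (rule exI[of _ z], unfold Let_def c, intro conjI allI impI)
    show "global_solution \<psi> V z0 z" by (rule sol)
    fix t :: real assume t: "t \<ge> 0"
    show "w t = z t" if "global_solution \<psi> V z0 w" for w using that t by (rule unique)
    show "((\<lambda>s. hamiltonian V c (z s)) has_real_derivative
      - (centred c (snd (z t)) \<bullet> (Psi \<psi> (z t) ** centred c (snd (z t))))) (at t within {0..})"
      by (rule energy[OF t])
    show "- (centred c (snd (z t)) \<bullet> (Psi \<psi> (z t) ** centred c (snd (z t)))) \<le> 0"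
      using Psi_nonneg[of \<psi>, OF assms(2)] by simp
    show "c = mean_velocity (snd (z t))" by (rule mean[OF t, symmetric])
  qed
qed

end
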